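(* As $n\to\infty$, $R(n) = O(n^{1/3})$, $R_{\text{no3l}}(n) = O(n^{1/3})$, $R_{\text{no4c}}(n) = O(n^{\log_2(7)/3})$, and $R_{\text{gen}}(n) = O(n^{\log_2(7)/3})$.
   Context: An angle determined by a finite set $\mathcal Q\subset\mathbb{R}^2$ is given by a center $q\in\mathcal Q$ and an unordered pair $\{p,r\}$ of distinct endpoints in $\mathcal Q\setminus\{q\}$, with measure $\angle pqr$; angles of measure $0$ or $\pi$ are ignored. $\mathcal Q$ determines no repeated angle if no two different such angles have equal measure in $(0,\pi)$. For a finite set $\mathcal{P}\subset\mathbb{R}^2$, $R(\mathcal P)$ is the maximum size of a subset $\mathcal Q\subseteq\mathcal P$ that determines no repeated angle. $R(n)$ is the minimum of $R(\mathcal P)$ over all sets $\mathcal P\subset\mathbb{R}^2$ of $n$ points, not all collinear. $R_{\text{no3l}}(n)$, $R_{\text{no4c}}(n)$, $R_{\text{gen}}(n)$ are the same minimum restricted further to, respectively, sets with no three collinear points; sets with no four points on a common circle; sets in general position (no three points collinear and no four points on a common circle). $f = O(g)$ means there is a constant $C$ with $f(n) \le C g(n)$ for all sufficiently large $n$. *)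

theory Defs
  imports "HOL-Analysis.Analysis" "HOL-Library.Landau_Symbols"
begin

text \<open>The measure of the angle with center \<open>q\<close> and endpoints \<open>p\<close>, \<open>r\<close>, as a value in \<open>[0, pi]\<close>.
  It is only meaningful for \<open>p \<noteq> q\<close> and \<open>r \<noteq> q\<close>.\<close>

definition angle_measure :: "'a::real_inner \<Rightarrow> 'a \<Rightarrow> 'a \<Rightarrow> real" where
  "angle_measure p q r = arccos (((p - q) \<bullet> (r - q)) / (norm (p - q) * norm (r - q)))"

text \<open>Two triples \<open>(p, q, r)\<close> denote the same angle iff they have the same center \<open>q\<close> and the same
  unordered pair \<open>{p, r}\<close> of endpoints, so that
  \<open>angle_measure p q r = angle_measure r q p\<close> does not count as a repetition.\<close>

definition angles :: "(real^2) set \<Rightarrow> ((real^2) \<times> (real^2) \<times> (real^2)) set" where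
  "angles Q = {(p, q, r). p \<in> Q \<and> q \<in> Q \<and> r \<in> Q \<and> p \<noteq> q \<and> r \<noteq> q \<and> p \<noteq> r \<and>
                 0 < angle_measure p q r \<and> angle_measure p q r < pi}"

definition no_repeated_angle :: "(real^2) set \<Rightarrow> bool" where
  "no_repeated_angle Q \<longleftrightarrow>
     (\<forall>(p, q, r) \<in> angles Q. \<forall>(p', q', r') \<in> angles Q.
        angle_measure p q r = angle_measure p' q' r' \<longrightarrow> q = q' \<and> {p, r} = {p', r'})"

definition R_set :: "(real^2) set \<Rightarrow> nat" where
  "R_set P = Max {card Q |Q. Q \<subseteq> P \<and> no_repeated_angle Q}"

definition no_three_collinear :: "(real^2) set \<Rightarrow> bool" where
  "no_three_collinear P \<longleftrightarrow> (\<forall>S \<subseteq> P. card S = 3 \<longrightarrow> \<not> collinear S)"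

definition no_four_concyclic :: "(real^2) set \<Rightarrow> bool" where
  "no_four_concyclic P \<longleftrightarrow>
     (\<forall>S \<subseteq> P. card S = 4 \<longrightarrow> \<not> (\<exists>c \<rho>. \<rho> > 0 \<and> S \<subseteq> sphere c \<rho>))"

text \<open>The minimum ranges over a set of naturals bounded by \<open>n\<close>. For \<open>n < 3\<close> there are no
  admissible point sets and the value is unspecified.\<close>

definition R_min :: "((real^2) set \<Rightarrow> bool) \<Rightarrow> nat \<Rightarrow> nat" where
  "R_min F n = Min {R_set P |P. finite P \<and> card P = n \<and> \<not> collinear P \<and> F P}"

definition R :: "nat \<Rightarrow> nat" where
  "R = R_min (\<lambda>P. True)"

definition R_no3l :: "nat \<Rightarrow> nat" where
  "R_no3l = R_min no_three_collinear"

definition R_no4c :: "nat \<Rightarrow> nat" where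
  "R_no4c = R_min no_four_concyclic"

definition R_gen :: "nat \<Rightarrow> nat" where
  "R_gen = R_min (\<lambda>P. no_three_collinear P \<and> no_four_concyclic P)"

end

theory Submission
  imports Defs
begin

text \<open>
  If no three points of \<open>P\<close> are collinear and \<open>P\<close> determines at most \<open>D\<close> angle measures, then a
  subset of size \<open>k\<close> without repeated angles has \<open>k (k - 1) (k - 2) \<le> 2 D\<close>, because each measure
  belongs to at most two ordered triples; hence \<open>k = O(D powr (1/3))\<close>.

  A regular \<open>n\<close>-gon has \<open>O(n)\<close> angle measures by the inscribed angle theorem. For general position,
  take a generic projection to the plane of \<open>{0,1}\<^sup>d\<close> with \<open>n \<le> 2 ^ d \<le> 2 n\<close>. The measure of an
  angle \<open>p q r\<close> depends only on \<open>(p - q, r - q)\<close>, and each of the \<open>d\<close> coordinates of the cube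
  contributes only \<open>7\<close> possibilities to this pair, so there are at most
  \<open>7 ^ d = (2 ^ d) powr log 2 7\<close> measures. The projection is built one direction \<open>v\<close> at a time, as
  \<open>P \<union> (P + v)\<close>: every degeneracy to be avoided is a nonzero polynomial condition on \<open>v\<close>.
\<close>

subsection \<open>Counting angles\<close>

lemma angle_measure_commute: "angle_measure p q r = angle_measure r q p"
  by (simp add: angle_measure_def inner_commute mult.commute)

text \<open>Non-collinearity excludes the equality case of Cauchy-Schwarz, so the cosine lies
  strictly between -1 and 1.\<close>

lemma angle_measure_strict:
  fixes p q r :: "'a::euclidean_space"
  assumes "\<not> collinear {p, q, r}"
  shows "0 < angle_measure p q r" "angle_measure p q r < pi"
proof -
  let ?c = "((p - q) \<bullet> (r - q)) / (norm (p - q) * norm (r - q))"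
  have nc: "\<not> collinear {0, p - q, r - q}"
    using assms by (simp add: collinear_3)
  hence nz: "p - q \<noteq> 0" "r - q \<noteq> 0"
    by (auto simp: insert_commute)
  have "\<bar>(p - q) \<bullet> (r - q)\<bar> \<noteq> norm (p - q) * norm (r - q)"
    using nc norm_cauchy_schwarz_equal by blast
  hence "\<bar>(p - q) \<bullet> (r - q)\<bar> < norm (p - q) * norm (r - q)"
    using Cauchy_Schwarz_ineq2[of "p - q" "r - q"] by linarith
  hence "\<bar>?c\<bar> < 1"
    using nz by (simp add: abs_mult)
  hence "-1 < ?c" "?c < 1" by linarith+
  from arccos_lt_bounded[OF this] show "0 < angle_measure p q r" "angle_measure p q r < pi"
    by (auto simp: angle_measure_def)
qed

lemma no_three_collinear_subset:
  "no_three_collinear P \<Longrightarrow> Q \<subseteq> P \<Longrightarrow> no_three_collinear Q"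
  unfolding no_three_collinear_def by (meson order_trans)

lemma no_four_concyclic_subset:
  "no_four_concyclic P \<Longrightarrow> Q \<subseteq> P \<Longrightarrow> no_four_concyclic Q"
  unfolding no_four_concyclic_def by (meson order_trans)

lemma no_three_collinearD:
  assumes "no_three_collinear P" "p \<in> P" "q \<in> P" "r \<in> P" "p \<noteq> q" "r \<noteq> q" "p \<noteq> r"
  shows "\<not> collinear {p, q, r}"
proof -
  have "card {p, q, r} = 3" using assms by auto
  thus ?thesis using assms unfolding no_three_collinear_def by auto
qed

lemma card_distinct_triples:
  assumes "finite A"
  shows "card {(p, q, r). p \<in> A \<and> q \<in> A \<and> r \<in> A \<and> p \<noteq> q \<and> r \<noteq> q \<and> p \<noteq> r}
           = card A * (card A - 1) * (card A - 2)"
proof -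
  have eq: "{(p, q, r). p \<in> A \<and> q \<in> A \<and> r \<in> A \<and> p \<noteq> q \<and> r \<noteq> q \<and> p \<noteq> r}
     = Sigma A (\<lambda>p. Sigma (A - {p}) (\<lambda>q. A - {p, q}))"
    by auto
  have "card (Sigma (A - {p}) (\<lambda>q. A - {p, q})) = (card A - 1) * (card A - 2)" if "p \<in> A" for p
  proof -
    have "card (A - {p, q}) = card A - 2" if "q \<in> A - {p}" for q
      using that \<open>p \<in> A\<close> assms by (subst card_Diff_subset) auto
    thus ?thesis using assms that by (simp add: card_SigmaI)
  qed
  thus ?thesis unfolding eq using assms by (simp add: card_SigmaI)
qed

text \<open>Without collinear triples no angle has measure 0 or \<open>pi\<close>, so every ordered
  triple of distinct points survives in \<open>angles Q\<close>.\<close>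

lemma card_angles_no_three_collinear:
  assumes "finite Q" "no_three_collinear Q"
  shows "card (angles Q) = card Q * (card Q - 1) * (card Q - 2)"
proof -
  have "angles Q = {(p, q, r). p \<in> Q \<and> q \<in> Q \<and> r \<in> Q \<and> p \<noteq> q \<and> r \<noteq> q \<and> p \<noteq> r}"
    unfolding angles_def
    using no_three_collinearD[OF assms(2)] angle_measure_strict by blast
  thus ?thesis using card_distinct_triples[OF assms(1)] by simp
qed

lemma card_le_two_fibres:
  assumes "finite A" "\<And>y. y \<in> f ` A \<Longrightarrow> card {x \<in> A. f x = y} \<le> 2"
  shows "card A \<le> 2 * card (f ` A)"
proof -
  have "A = (\<Union>y\<in>f ` A. {x \<in> A. f x = y})" by auto
  hence "card A \<le> (\<Sum>y\<in>f ` A. card {x \<in> A. f x = y})"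
    using card_UN_le[of "f ` A" "\<lambda>y. {x \<in> A. f x = y}"] assms(1) by simp
  also have "\<dots> \<le> (\<Sum>y\<in>f ` A. 2)" using assms(2) by (rule sum_mono)
  finally show ?thesis by simp
qed

lemma no_repeated_angleD:
  assumes "no_repeated_angle Q" "(p, q, r) \<in> angles Q" "(p', q', r') \<in> angles Q"
    "angle_measure p q r = angle_measure p' q' r'"
  shows "q = q' \<and> {p, r} = {p', r'}"
  using assms(1)[unfolded no_repeated_angle_def, THEN bspec, OF assms(2), unfolded prod.case,
      THEN bspec, OF assms(3)] assms(4) by simp

text \<open>Angles of equal measure share center and endpoint pair, so a fibre of the measure holds
  at most a triple and its reversal; hence the factor 2.\<close>

lemma card_angles_no_repeated:
  assumes "finite Q" "no_repeated_angle Q" "finite M"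
    and M: "\<And>p q r. (p, q, r) \<in> angles Q \<Longrightarrow> angle_measure p q r \<in> M"
  shows "card (angles Q) \<le> 2 * card M"
proof -
  define f where "f = (\<lambda>(p, q, r). angle_measure p q (r :: real^2))"
  have fin: "finite (angles Q)"
  proof (rule finite_subset)
    show "angles Q \<subseteq> Q \<times> Q \<times> Q" by (auto simp: angles_def)
  qed (simp add: assms(1))
  have fib: "card {x \<in> angles Q. f x = y} \<le> 2" if y: "y \<in> f ` angles Q" for y
  proof -
    obtain p q r where pqr: "(p, q, r) \<in> angles Q" "angle_measure p q r = y"
      using y unfolding f_def by fast
    have "x \<in> {(p, q, r), (r, q, p)}" if "x \<in> angles Q" "f x = y" for x
    proof -
      obtain p' q' r' where x: "x = (p', q', r')" by (metis prod_cases3)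
      have "(p', q', r') \<in> angles Q" "angle_measure p' q' r' = angle_measure p q r"
        using that pqr by (simp_all add: x f_def)
      hence "q' = q \<and> {p', r'} = {p, r}"
        using no_repeated_angleD[OF assms(2) _ pqr(1)] by simp
      thus ?thesis unfolding x by (auto simp: doubleton_eq_iff)
    qed
    hence "{x \<in> angles Q. f x = y} \<subseteq> {(p, q, r), (r, q, p)}" by blast
    hence "card {x \<in> angles Q. f x = y} \<le> card {(p, q, r), (r, q, p)}"
      by (rule card_mono[rotated]) simp
    also have "\<dots> \<le> 2" using card_length[of "[(p, q, r), (r, q, p)]"] by simp
    finally show ?thesis .
  qed
  have "card (angles Q) \<le> 2 * card (f ` angles Q)"
    using fin fib by (rule card_le_two_fibres)
  also have "f ` angles Q \<subseteq> M" using M unfolding f_def by fast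
  hence "2 * card (f ` angles Q) \<le> 2 * card M" using assms(3) by (simp add: card_mono)
  finally show ?thesis .
qed

section \<open>From triple counts to bounds on \<open>R_set\<close> and \<open>R_min\<close>\<close>

lemma R_set_attained:
  assumes "finite P"
  obtains Q where "Q \<subseteq> P" "no_repeated_angle Q" "R_set P = card Q"
proof -
  let ?S = "{card Q |Q. Q \<subseteq> P \<and> no_repeated_angle Q}"
  have "?S \<subseteq> card ` Pow P" by auto
  hence fin: "finite ?S" using assms finite_subset by blast
  \<comment> \<open>The empty subset is admissible, so \<open>Max\<close> ranges over a nonempty
    finite set and is attained.\<close>
  have "no_repeated_angle {}" by (auto simp: no_repeated_angle_def angles_def)
  hence "?S \<noteq> {}" by blast
  from Max_in[OF fin this] show ?thesis
    using that unfolding R_set_def by auto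
qed

lemma R_set_le:
  assumes "finite P" "no_three_collinear P" "finite M" "real (card M) \<le> D"
    and M: "\<And>p q r. (p, q, r) \<in> angles P \<Longrightarrow> angle_measure p q r \<in> M"
  shows "real (R_set P) \<le> 2 + (2 * D) powr (1/3)"
proof -
  obtain Q where Q: "Q \<subseteq> P" "no_repeated_angle Q" "R_set P = card Q"
    using R_set_attained[OF assms(1)] .
  have finQ: "finite Q" using Q assms(1) finite_subset by blast
  have sub: "angles Q \<subseteq> angles P" using Q(1) by (auto simp: angles_def)
  define k where "k = card Q"
  have le: "k * (k - 1) * (k - 2) \<le> 2 * card M"
    using card_angles_no_repeated[OF finQ Q(2) assms(3)] M sub
      card_angles_no_three_collinear[OF finQ no_three_collinear_subset[OF assms(2) Q(1)]]
    unfolding k_def by fastforce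
  \<comment> \<open>A perfect cube below the product permits a cube root; truncated subtraction
    keeps this valid for \<open>k < 2\<close>.\<close>
  have "(k - 2) * (k - 2) * (k - 2) \<le> k * (k - 1) * (k - 2)"
    by (intro mult_mono) auto
  hence "(k - 2) ^ 3 \<le> 2 * card M" using le unfolding power3_eq_cube by (rule order_trans)
  hence "real ((k - 2) ^ 3) \<le> real (2 * card M)" by (simp only: of_nat_le_iff)
  hence "real (k - 2) ^ 3 \<le> 2 * D" using assms(4) by simp
  hence "(real (k - 2) ^ 3) powr (1/3) \<le> (2 * D) powr (1/3)"
    by (intro powr_mono2) auto
  also have "(real (k - 2) ^ 3) powr (1/3) = real (k - 2)"
    by (cases "k - 2 = 0") (simp_all add: powr_powr flip: powr_numeral)
  finally show ?thesis unfolding Q(3) k_def[symmetric] by linarith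
qed

text \<open>One witness bounds the minimum from above. All competing values are at most
  \<open>card P\<close>, so \<open>Min\<close> is taken over a finite set.\<close>

lemma R_min_le:
  assumes "finite P" "3 \<le> card P" "no_three_collinear P" "F P"
  shows "R_min F (card P) \<le> R_set P"
proof -
  let ?S = "{R_set P' |P'. finite P' \<and> card P' = card P \<and> \<not> collinear P' \<and> F P'}"
  have "?S \<subseteq> {..card P}"
  proof safe
    fix P' :: "(real^2) set" assume "finite P'" "card P' = card P"
    then obtain Q where "Q \<subseteq> P'" "R_set P' = card Q" using R_set_attained by metis
    thus "R_set P' \<le> card P" using card_mono[OF \<open>finite P'\<close>] \<open>card P' = card P\<close> by metis
  qed
  hence fin: "finite ?S" by (rule finite_subset) simp
  obtain S where "S \<subseteq> P" "card S = 3" using obtain_subset_with_card_n[OF assms(2)] .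
  hence "\<not> collinear P"
    using assms(3) collinear_subset[of P S] unfolding no_three_collinear_def by metis
  hence "R_set P \<in> ?S" using assms(1,4) by (intro CollectI exI[of _ P]) simp
  thus ?thesis unfolding R_min_def using fin by (rule Min_le[rotated])
qed

subsection \<open>Regular polygons\<close>

definition circle_point :: "real \<Rightarrow> real^2" where
  "circle_point t = vector [cos t, sin t]"

definition circle_tangent :: "real \<Rightarrow> real^2" where
  "circle_tangent t = vector [- sin t, cos t]"

text \<open>Sum-to-product: a chord is parallel to the tangent at the midpoint of the two
  parameters.\<close>

lemma circle_chord:
  "circle_point a - circle_point c = (2 * sin ((a - c) / 2)) *\<^sub>R circle_tangent ((a + c) / 2)"
proof -
  have "sin ((c - a) / 2) = - sin ((a - c) / 2)"
    by (simp flip: sin_minus add: minus_divide_left)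
  thus ?thesis
    by (simp add: circle_point_def circle_tangent_def vec_eq_iff forall_2 cos_diff_cos sin_diff_sin)
qed

lemma inner_circle_tangent: "circle_tangent a \<bullet> circle_tangent b = cos (a - b)"
  by (simp add: circle_tangent_def inner_vec_def sum_2 cos_diff)

lemma norm_circle_tangent: "norm (circle_tangent a) = 1"
  by (simp add: norm_eq_sqrt_inner inner_circle_tangent)

text \<open>The inscribed angle theorem: the chords from \<open>c\<close> follow the tangents at
  \<open>(a + c) / 2\<close> and \<open>(b + c) / 2\<close>, whose difference is free of
  \<open>c\<close>. The signs of the two chord factors leave two possible values.\<close>

lemma circle_angle_measure:
  assumes "circle_point a \<noteq> circle_point c" "circle_point b \<noteq> circle_point c"
  shows "angle_measure (circle_point a) (circle_point c) (circle_point b)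
           \<in> {arccos (cos ((a - b) / 2)), arccos (- cos ((a - b) / 2))}"
proof -
  define x y where "x = 2 * sin ((a - c) / 2)" and "y = 2 * sin ((b - c) / 2)"
  have nz: "x \<noteq> 0" "y \<noteq> 0"
    using assms circle_chord[of a c] circle_chord[of b c] unfolding x_def y_def by auto
  have "angle_measure (circle_point a) (circle_point c) (circle_point b)
      = arccos (x * y * cos ((a + c) / 2 - (b + c) / 2) / (\<bar>x\<bar> * \<bar>y\<bar>))"
    unfolding angle_measure_def circle_chord x_def y_def
    by (simp add: inner_circle_tangent norm_circle_tangent mult_ac)
  also have "(a + c) / 2 - (b + c) / 2 = (a - b) / 2" by (simp add: field_simps)
  finally show ?thesis using nz by (auto simp: abs_if)
qed

definition cross2 :: "real^2 \<Rightarrow> real^2 \<Rightarrow> real" where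
  "cross2 u w = u$1 * w$2 - u$2 * w$1"

lemma collinear_imp_cross2:
  assumes "collinear {a, b, c}"
  shows "cross2 (b - a) (c - a) = 0"
proof -
  obtain u where u: "\<forall>x\<in>{a,b,c}. \<forall>y\<in>{a,b,c}. \<exists>k. x - y = k *\<^sub>R u"
    using assms unfolding collinear_def by blast
  then obtain k l where "b - a = k *\<^sub>R u" "c - a = l *\<^sub>R u" by blast
  thus ?thesis by (simp add: cross2_def)
qed

lemma no_three_collinearI:
  assumes "\<And>a b c. \<lbrakk>a \<in> P; b \<in> P; c \<in> P; a \<noteq> b; a \<noteq> c; b \<noteq> c\<rbrakk> \<Longrightarrow> cross2 (b - a) (c - a) \<noteq> 0"
  shows "no_three_collinear P"
  unfolding no_three_collinear_def
proof safe
  fix S assume S: "S \<subseteq> P" "card S = 3" "collinear S"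
  then obtain a b c where "S = {a, b, c}" "a \<noteq> b" "a \<noteq> c" "b \<noteq> c"
    by (auto simp: card_3_iff)
  thus False using S assms[of a b c] collinear_imp_cross2[of a b c] by auto
qed

lemma sin_half_diff_nonzero:
  assumes "x \<in> {0..<2*pi}" "y \<in> {0..<2*pi}" "x \<noteq> y"
  shows "sin ((x - y) / 2) \<noteq> 0"
proof (cases "y < x")
  case True
  have "sin ((x - y) / 2) > 0" using assms True by (intro sin_gt_zero) auto
  thus ?thesis by simp
next
  case False
  have "sin ((y - x) / 2) > 0" using assms False by (intro sin_gt_zero) auto
  moreover have "sin ((x - y) / 2) = - sin ((y - x) / 2)"
    by (simp flip: sin_minus add: minus_divide_left)
  ultimately show ?thesis by simp
qed

text \<open>Factor both chords by \<open>circle_chord\<close>; two unit tangents have as determinant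
  the sine of their parameter difference. With parameters in \<open>[0, 2 pi)\<close> the product
  vanishes only if two of them agree.\<close>

lemma cross2_circle_point:
  "cross2 (circle_point b - circle_point a) (circle_point c - circle_point a)
     = 4 * sin ((b - a) / 2) * sin ((c - a) / 2) * sin ((c - b) / 2)"
proof -
  have "cross2 (circle_tangent s) (circle_tangent t) = sin (t - s)" for s t
    by (simp add: cross2_def circle_tangent_def sin_diff)
  moreover have "cross2 (k *\<^sub>R u) (l *\<^sub>R w) = k * l * cross2 u w" for k l u w
    by (simp add: cross2_def algebra_simps)
  moreover have "(c + a) / 2 - (b + a) / 2 = (c - b) / 2" by (simp add: field_simps)
  ultimately show ?thesis unfolding circle_chord by (simp only: mult_ac)
qed

lemma few_angles_no_three_collinear:
  assumes "n > 0"
  obtains P M where "finite P" "card P = n" "no_three_collinear P"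
    "finite M" "card M \<le> 2 * n"
    "\<And>p q r. (p, q, r) \<in> angles P \<Longrightarrow> angle_measure p q r \<in> M"
proof -
  define \<theta> where "\<theta> = (\<lambda>k. 2 * pi * real k / real n)"
  define P where "P = (circle_point \<circ> \<theta>) ` {..<n}"
  define C where "C = (\<lambda>m::nat. cos (pi * real m / real n))"
  define M where "M = (arccos \<circ> C) ` {..<n} \<union> (\<lambda>m. arccos (- C m)) ` {..<n}"
  have range: "\<theta> k \<in> {0..<2*pi}" if "k < n" for k
    using that assms by (auto simp: \<theta>_def field_simps)
  have inj: "inj_on \<theta> {..<n}"
    using assms by (auto simp: inj_on_def \<theta>_def)
  have sin_nz: "sin ((\<theta> j - \<theta> k) / 2) \<noteq> 0" if "j < n" "k < n" "j \<noteq> k" for j k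
    using that range inj by (intro sin_half_diff_nonzero) (auto simp: inj_on_def)
  have inj_P: "inj_on (circle_point \<circ> \<theta>) {..<n}"
  proof (rule inj_onI)
    fix j k assume jk: "j \<in> {..<n}" "k \<in> {..<n}" "(circle_point \<circ> \<theta>) j = (circle_point \<circ> \<theta>) k"
    have "circle_tangent ((\<theta> j + \<theta> k) / 2) \<noteq> 0"
      using norm_circle_tangent by (metis norm_zero zero_neq_one)
    thus "j = k" using jk sin_nz[of j k] circle_chord[of "\<theta> j" "\<theta> k"] by auto
  qed
  show thesis
  proof (rule that[of P M])
    show "finite P" "finite M" by (auto simp: P_def M_def)
    show "card P = n" using inj_P unfolding P_def by (subst card_image) auto
    have "card M \<le> card ((arccos \<circ> C) ` {..<n}) + card ((\<lambda>m. arccos (- C m)) ` {..<n})"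
      unfolding M_def by (rule card_Un_le)
    also have "\<dots> \<le> n + n"
      by (intro add_mono order_trans[OF card_image_le]) auto
    finally show "card M \<le> 2 * n" by simp
    show "no_three_collinear P"
    proof (rule no_three_collinearI)
      fix a b c assume "a \<in> P" "b \<in> P" "c \<in> P" "a \<noteq> b" "a \<noteq> c" "b \<noteq> c"
      then obtain i j k where ijk: "i < n" "j < n" "k < n" "i \<noteq> j" "i \<noteq> k" "j \<noteq> k"
        "a = circle_point (\<theta> i)" "b = circle_point (\<theta> j)" "c = circle_point (\<theta> k)"
        unfolding P_def by auto
      thus "cross2 (b - a) (c - a) \<noteq> 0"
        using sin_nz[of j i] sin_nz[of k i] sin_nz[of k j] by (simp add: cross2_circle_point)
    qed
    fix p q r assume "(p, q, r) \<in> angles P"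
    then obtain i j k where ijk: "i < n" "j < n" "k < n" "p \<noteq> q" "r \<noteq> q"
        "p = circle_point (\<theta> i)" "q = circle_point (\<theta> j)" "r = circle_point (\<theta> k)"
      unfolding angles_def P_def by auto
    \<comment> \<open>Cosine is even, so only the absolute index difference matters:
      \<open>n\<close> values of \<open>m\<close>, each with two signs.\<close>
    define m where "m = (if i \<le> k then k - i else i - k)"
    have "m < n" using ijk by (auto simp: m_def)
    have "cos ((\<theta> i - \<theta> k) / 2) = C m"
    proof (cases "i \<le> k")
      case True
      have "(\<theta> i - \<theta> k) / 2 = - (pi * real m / real n)"
        using True assms by (simp add: \<theta>_def m_def of_nat_diff field_simps)
      thus ?thesis by (simp add: C_def)
    next
      case False
      have "(\<theta> i - \<theta> k) / 2 = pi * real m / real n"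
        using False assms by (simp add: \<theta>_def m_def of_nat_diff field_simps)
      thus ?thesis by (simp add: C_def)
    qed
    thus "angle_measure p q r \<in> M"
      using circle_angle_measure[of "\<theta> i" "\<theta> j" "\<theta> k"] ijk \<open>m < n\<close> by (auto simp: M_def)
  qed
qed

subsection \<open>Generic projections of the cube\<close>

text \<open>The determinant with rows \<open>(p \<bullet> p, p$1, p$2)\<close> for \<open>p\<close> among \<open>b - a\<close>, \<open>c - a\<close>, \<open>d - a\<close>.\<close>

definition incircle :: "real^2 \<Rightarrow> real^2 \<Rightarrow> real^2 \<Rightarrow> real^2 \<Rightarrow> real" where
  "incircle a b c d =
     ((b - a) \<bullet> (b - a)) * cross2 (c - a) (d - a)
     - ((c - a) \<bullet> (c - a)) * cross2 (b - a) (d - a)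
     + ((d - a) \<bullet> (d - a)) * cross2 (b - a) (c - a)"

text \<open>Stated through nonvanishing polynomials, so that each bad translation is a root of some
  polynomial.\<close>

definition general_position :: "(real^2) set \<Rightarrow> bool" where
  "general_position P \<longleftrightarrow>
     (\<forall>a\<in>P. \<forall>b\<in>P. \<forall>c\<in>P. a \<noteq> b \<longrightarrow> a \<noteq> c \<longrightarrow> b \<noteq> c \<longrightarrow> cross2 (b - a) (c - a) \<noteq> 0) \<and>
     (\<forall>a\<in>P. \<forall>b\<in>P. \<forall>c\<in>P. \<forall>d\<in>P. distinct [a, b, c, d] \<longrightarrow> incircle a b c d \<noteq> 0)"

text \<open>On a circle through \<open>a\<close> with center \<open>z\<close>, the squared length of
  \<open>x - a\<close> is the linear form \<open>2 * ((x - a) \<bullet> (z - a))\<close>; the first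
  column of the determinant thus depends linearly on the other two.\<close>

lemma concyclic_imp_incircle:
  assumes "{a, b, c, d} \<subseteq> sphere z \<rho>"
  shows "incircle a b c d = 0"
proof -
  have "(x - a) \<bullet> (x - a) = 2 * ((x - a) \<bullet> (z - a))" if "x \<in> {b, c, d}" for x
  proof -
    have "norm (z - x) = norm (z - a)" using assms that by (auto simp: dist_norm)
    hence "(z - x) \<bullet> (z - x) = (z - a) \<bullet> (z - a)" by (simp add: norm_eq)
    thus ?thesis by (simp add: algebra_simps inner_commute)
  qed
  hence *: "(b - a) \<bullet> (b - a) = 2 * ((b - a) \<bullet> (z - a))"
    "(c - a) \<bullet> (c - a) = 2 * ((c - a) \<bullet> (z - a))"
    "(d - a) \<bullet> (d - a) = 2 * ((d - a) \<bullet> (z - a))" by auto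
  show ?thesis unfolding incircle_def *
    by (simp add: cross2_def inner_vec_def sum_2 algebra_simps)
qed

lemma general_position_imp:
  assumes "general_position P"
  shows "no_three_collinear P" "no_four_concyclic P"
proof -
  show "no_three_collinear P"
    using assms unfolding general_position_def by (intro no_three_collinearI) blast
  show "no_four_concyclic P"
    unfolding no_four_concyclic_def
  proof safe
    fix S z \<rho> assume S: "S \<subseteq> P" "card S = 4" "S \<subseteq> sphere z \<rho>"
    then obtain xs where xs: "set xs = S" "distinct xs"
      using finite_distinct_list[of S] by (metis card.infinite zero_neq_numeral)
    hence "length xs = 4" using S(2) distinct_card by metis
    then obtain a b c d where abcd: "xs = [a, b, c, d]"
      by (auto simp: numeral_eq_Suc length_Suc_conv)
    have "{a, b, c, d} \<subseteq> sphere z \<rho>" using xs abcd S by auto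
    from concyclic_imp_incircle[OF this] show False
      using assms xs abcd S unfolding general_position_def by auto
  qed
qed

text \<open>The value agrees up to sign with the 4x4 determinant with rows
  \<open>(p \<bullet> p, p$1, p$2, 1)\<close>, which is alternating. Adjacent transpositions
  generate all permutations.\<close>

lemma incircle_swap:
  "incircle b a c d = - incircle a b c d"
  "incircle a c b d = - incircle a b c d"
  "incircle a b d c = - incircle a b c d"
  unfolding incircle_def by (simp_all add: cross2_def inner_vec_def sum_2 algebra_simps)

text \<open>The first three facts move \<open>d\<close> to each other position; the last five move
  the ordered pair \<open>c\<close>, \<open>d\<close> to each other pair of positions.\<close>

lemma incircle_nonzero_perms:
  assumes "incircle a b c d \<noteq> 0"
  shows "incircle a b d c \<noteq> 0" "incircle a d b c \<noteq> 0" "incircle d a b c \<noteq> 0"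
    "incircle a c b d \<noteq> 0" "incircle a c d b \<noteq> 0" "incircle c a b d \<noteq> 0"
    "incircle c a d b \<noteq> 0" "incircle c d a b \<noteq> 0"
  using assms incircle_swap(3)[of a b c d] incircle_swap(2)[of a b d c] incircle_swap(1)[of a d b c]
    incircle_swap(2)[of a b c d] incircle_swap(3)[of a c b d] incircle_swap(1)[of a c b d]
    incircle_swap(3)[of c a b d] incircle_swap(2)[of c a d b]
  by simp_all

lemma incircle_translate: "incircle (a + v) (b + v) (c + v) (d + v) = incircle a b c d"
  by (simp add: incircle_def)

section \<open>Generic translations along a cubic curve\<close>

definition cubic_point :: "real \<Rightarrow> real^2" where
  "cubic_point t = vector [t, t^3]"

text \<open>On the curve \<open>y = x^3\<close> the six monomials of degree at most two become distinct powers
  of the parameter.\<close>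

lemma finite_quadratic_on_cubic:
  assumes "\<not> (\<alpha> = 0 \<and> \<beta> = 0 \<and> \<gamma> = 0 \<and> \<delta> = 0 \<and> \<epsilon> = 0 \<and> \<zeta> = 0)"
    and f: "\<And>w. f w = \<alpha> * (w$1)^2 + \<beta> * (w$1 * w$2) + \<gamma> * (w$2)^2 + \<delta> * w$1 + \<epsilon> * w$2 + \<zeta>"
  shows "finite {t. f (cubic_point t + k) = (0::real)}"
proof -
  define x y where "x = k$1" and "y = k$2"
  define p where "p = [:\<zeta> + \<delta> * x + \<epsilon> * y + \<alpha> * x^2 + \<beta> * x * y + \<gamma> * y^2,
      \<delta> + 2 * \<alpha> * x + \<beta> * y, \<alpha>, \<epsilon> + \<beta> * x + 2 * \<gamma> * y, \<beta>, 0, \<gamma>:]"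
  \<comment> \<open>The shift by \<open>k\<close> mixes coefficients only triangularly: degrees 6,
    4, 2 give \<gamma>, \<beta>, \<alpha>; then degrees 3, 1, 0 give \<epsilon>, \<delta>,
    \<zeta>.\<close>
  have "p \<noteq> 0"
    using assms(1) by (auto simp: p_def)
  hence "finite {t. poly p t = 0}" by (rule poly_roots_finite)
  moreover have "poly p t = f (cubic_point t + k)" for t
    unfolding f p_def cubic_point_def x_def y_def
    by (simp add: algebra_simps power2_eq_square power3_eq_cube)
  ultimately show ?thesis by simp
qed

lemma finite_cubic_point_eq: "finite {t. cubic_point t = k}"
proof (rule finite_subset)
  show "{t. cubic_point t = k} \<subseteq> {k$1}" by (auto simp: cubic_point_def)
qed simp

lemma finite_cross2:
  assumes "a \<noteq> b"
  shows "finite {t. cross2 (b - a) (cubic_point t + k) = 0}"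
  by (rule finite_quadratic_on_cubic[of 0 0 0 "- (b - a)$2" "(b - a)$1" 0])
     (use assms in \<open>auto simp: cross2_def vec_eq_iff forall_2 algebra_simps\<close>)

text \<open>With the origin at \<open>a\<close>, the quadratic part in the fourth point is
  \<open>?m * (w \<bullet> w)\<close>, and \<open>?m\<close> is nonzero by assumption.\<close>

lemma finite_incircle_3_1:
  assumes "cross2 (b - a) (c - a) \<noteq> 0"
  shows "finite {t. incircle a b c (cubic_point t + (k + a)) = 0}"
proof -
  let ?m = "cross2 (b - a) (c - a)" and ?nb = "(b - a) \<bullet> (b - a)" and ?nc = "(c - a) \<bullet> (c - a)"
  define f where "f = (\<lambda>w. incircle a b c (w + a))"
  have "finite {t. f (cubic_point t + k) = 0}"
    by (rule finite_quadratic_on_cubic[of ?m 0 ?m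
          "- ?nb * (c - a)$2 + ?nc * (b - a)$2" "?nb * (c - a)$1 - ?nc * (b - a)$1" 0])
       (use assms in \<open>auto simp: f_def incircle_def cross2_def inner_vec_def sum_2 power2_eq_square
          algebra_simps\<close>)
  thus ?thesis by (simp add: f_def add_ac)
qed

text \<open>With \<open>u = b - a\<close> and \<open>e = d - c\<close>, the linear part of the determinant vanishes only if
  \<open>u = e\<close>, and then the quadratic part does not.\<close>

lemma finite_incircle_2_2:
  assumes "a \<noteq> b" "c \<noteq> d"
  shows "finite {t. incircle a b (cubic_point t + c) (cubic_point t + d) = 0}"
proof -
  define u e where "u = b - a" and "e = d - c"
  define f where "f = (\<lambda>w. (u \<bullet> u) * cross2 w e - (w \<bullet> w) * cross2 u e
                     + (2 * (w \<bullet> e) + e \<bullet> e) * cross2 u w)"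
  let ?s = "u$1 * e$2 + u$2 * e$1"
  let ?p = "(u \<bullet> u) *\<^sub>R e - (e \<bullet> e) *\<^sub>R u"
  have "\<not> (- ?s = 0 \<and> 2 * (e$1 * u$1 - e$2 * u$2) = 0 \<and> ?s = 0 \<and> ?p$2 = 0 \<and> - ?p$1 = 0 \<and> (0::real) = 0)"
  proof
    assume *: "- ?s = 0 \<and> 2 * (e$1 * u$1 - e$2 * u$2) = 0 \<and> ?s = 0 \<and> ?p$2 = 0 \<and> - ?p$1 = 0 \<and> (0::real) = 0"
    have ue: "u \<noteq> 0" "e \<noteq> 0" using assms by (auto simp: u_def e_def)
    have p: "(u \<bullet> u) *\<^sub>R e = (e \<bullet> e) *\<^sub>R u" using * by (simp add: vec_eq_iff forall_2)
    hence "norm ((u \<bullet> u) *\<^sub>R e) = norm ((e \<bullet> e) *\<^sub>R u)" by simp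
    hence "norm u = norm e" using ue by (simp add: power2_eq_square flip: power2_norm_eq_inner)
    hence "u \<bullet> u = e \<bullet> e" by (simp add: norm_eq)
    hence "u = e" using p ue by simp
    \<comment> \<open>For \<open>u = e\<close> the quadratic coefficients are, up to sign, twice
      these product and difference.\<close>
    with * have "u$1 * u$2 = 0" "u$1 * u$1 = u$2 * u$2" by (auto simp: algebra_simps)
    hence "u = 0" by (auto simp: vec_eq_iff forall_2)
    with ue show False by simp
  qed
  moreover have "f w = - ?s * (w$1)^2 + (2 * (e$1 * u$1 - e$2 * u$2)) * (w$1 * w$2) + ?s * (w$2)^2
       + ?p$2 * w$1 + (- ?p$1) * w$2 + 0" for w
    by (simp add: f_def cross2_def inner_vec_def sum_2 power2_eq_square algebra_simps)
  ultimately have "finite {t. f (cubic_point t + (c - a)) = 0}"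
    by (rule finite_quadratic_on_cubic)
  moreover have "incircle a b (w + c) (w + d) = f (w + (c - a))" for w
  proof -
    define y where "y = w + (c - a)"
    have *: "w + c - a = y" "w + d - a = y + e" by (auto simp: y_def e_def)
    \<comment> \<open>After expansion the cubic terms \<open>(y \<bullet> y) * cross2 u y\<close>
      cancel, leaving a polynomial of degree two in \<open>y\<close>.\<close>
    have "cross2 y (y + e) = cross2 y e" "cross2 u (y + e) = cross2 u y + cross2 u e"
      "(y + e) \<bullet> (y + e) = y \<bullet> y + (2 * (y \<bullet> e) + e \<bullet> e)"
      by (simp_all add: cross2_def algebra_simps inner_commute)
    thus ?thesis
      unfolding incircle_def f_def * u_def[symmetric] y_def[symmetric]
      by (simp add: algebra_simps)
  qed
  ultimately show ?thesis by simp
qed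

lemma cofinite_generic_translation:
  shows "\<forall>\<^sub>F t in cofinite. cubic_point t \<noteq> k"
    and "a \<noteq> b \<Longrightarrow> \<forall>\<^sub>F t in cofinite. cross2 (b - a) (cubic_point t + k) \<noteq> 0"
    and "cross2 (b - a) (c - a) \<noteq> 0 \<Longrightarrow>
      \<forall>\<^sub>F t in cofinite. incircle a b c (d + cubic_point t) \<noteq> 0"
    and "cross2 (b - a) (c - a) \<noteq> 0 \<Longrightarrow>
      \<forall>\<^sub>F t in cofinite. incircle a b c (d - cubic_point t) \<noteq> 0"
    and "a \<noteq> b \<Longrightarrow> c \<noteq> d \<Longrightarrow>
      \<forall>\<^sub>F t in cofinite. incircle a b (c + cubic_point t) (d + cubic_point t) \<noteq> 0"
proof -
  show "\<forall>\<^sub>F t in cofinite. cubic_point t \<noteq> k"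
    using finite_cubic_point_eq by (simp add: eventually_cofinite)
  show "\<forall>\<^sub>F t in cofinite. cross2 (b - a) (cubic_point t + k) \<noteq> 0" if "a \<noteq> b"
    using finite_cross2[OF that] by (simp add: eventually_cofinite)
  show "\<forall>\<^sub>F t in cofinite. incircle a b (c + cubic_point t) (d + cubic_point t) \<noteq> 0"
    if "a \<noteq> b" "c \<noteq> d"
    using finite_incircle_2_2[OF that] by (simp add: eventually_cofinite add.commute)
  assume "cross2 (b - a) (c - a) \<noteq> 0"
  from finite_incircle_3_1[OF this, of "d - a"]
  have fin: "finite {t. incircle a b c (d + cubic_point t) = 0}" by (simp add: add.commute)
  thus "\<forall>\<^sub>F t in cofinite. incircle a b c (d + cubic_point t) \<noteq> 0"
    by (simp add: eventually_cofinite)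
  \<comment> \<open>The curve is odd, so a backward translation is a forward one with parameter
    \<open>- t\<close>.\<close>
  have "cubic_point (- t) = - cubic_point t" for t
    by (simp add: cubic_point_def vec_eq_iff forall_2)
  hence "{t. incircle a b c (d - cubic_point t) = 0}
      = uminus -` {t. incircle a b c (d + cubic_point t) = 0}"
    by (simp add: vimage_def)
  also have "finite \<dots>" using fin by (rule finite_vimageI) simp
  finally show "\<forall>\<^sub>F t in cofinite. incircle a b c (d - cubic_point t) \<noteq> 0"
    by (simp add: eventually_cofinite)
qed

text \<open>Degeneracies are sorted by which points are shifted. Each case forbids finitely many
  parameters, there are finitely many cases, and the reals are infinite.\<close>

lemma general_position_double:
  assumes "finite P" "general_position P"
  obtains v where "(\<lambda>p. p + v) ` P \<inter> P = {}" "general_position (P \<union> (\<lambda>p. p + v) ` P)"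
proof -
  have cr0: "cross2 (b - a) (c - a) \<noteq> 0"
    if "a \<in> P" "b \<in> P" "c \<in> P" "a \<noteq> b" "a \<noteq> c" "b \<noteq> c" for a b c
    using assms(2) that unfolding general_position_def by blast
  have in0: "incircle a b c d \<noteq> 0"
    if "a \<in> P" "b \<in> P" "c \<in> P" "d \<in> P" "distinct [a, b, c, d]" for a b c d
    using assms(2) that unfolding general_position_def by blast
  note generic = cofinite_generic_translation
  have cofinite_neq_bot: "(cofinite :: real filter) \<noteq> bot"
    by (simp add: cofinite_bot infinite_UNIV_char_0)
  \<comment> \<open>In order: disjointness; one, then two shifted points among three; one, three,
    then two shifted points among four.\<close>
  have ev: "\<forall>\<^sub>F t in cofinite.
     (\<forall>a\<in>P. \<forall>b\<in>P. cubic_point t \<noteq> a - b) \<and>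
     (\<forall>a\<in>P. \<forall>b\<in>P. \<forall>c\<in>P. a \<noteq> b \<longrightarrow> cross2 (b - a) (cubic_point t + (c - a)) \<noteq> 0) \<and>
     (\<forall>a\<in>P. \<forall>b\<in>P. \<forall>c\<in>P. a \<noteq> b \<longrightarrow> cross2 (b - a) (cubic_point t + (a - c)) \<noteq> 0) \<and>
     (\<forall>a\<in>P. \<forall>b\<in>P. \<forall>c\<in>P. \<forall>d\<in>P. a \<noteq> b \<and> a \<noteq> c \<and> b \<noteq> c \<longrightarrow>
        incircle a b c (d + cubic_point t) \<noteq> 0) \<and>
     (\<forall>a\<in>P. \<forall>b\<in>P. \<forall>c\<in>P. \<forall>d\<in>P. a \<noteq> b \<and> a \<noteq> c \<and> b \<noteq> c \<longrightarrow>
        incircle a b c (d - cubic_point t) \<noteq> 0) \<and>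
     (\<forall>a\<in>P. \<forall>b\<in>P. \<forall>c\<in>P. \<forall>d\<in>P. a \<noteq> b \<and> c \<noteq> d \<longrightarrow>
        incircle a b (c + cubic_point t) (d + cubic_point t) \<noteq> 0)"
    by (intro eventually_conj eventually_ball_finite assms(1) ballI)
       (auto intro: generic(1,2,5) generic(3,4)[OF cr0] simp: eventually_const_iff)
  then obtain t where t:
    "\<forall>a\<in>P. \<forall>b\<in>P. cubic_point t \<noteq> a - b"
    "\<forall>a\<in>P. \<forall>b\<in>P. \<forall>c\<in>P. a \<noteq> b \<longrightarrow> cross2 (b - a) (cubic_point t + (c - a)) \<noteq> 0"
    "\<forall>a\<in>P. \<forall>b\<in>P. \<forall>c\<in>P. a \<noteq> b \<longrightarrow> cross2 (b - a) (cubic_point t + (a - c)) \<noteq> 0"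
    "\<forall>a\<in>P. \<forall>b\<in>P. \<forall>c\<in>P. \<forall>d\<in>P. a \<noteq> b \<and> a \<noteq> c \<and> b \<noteq> c \<longrightarrow>
        incircle a b c (d + cubic_point t) \<noteq> 0"
    "\<forall>a\<in>P. \<forall>b\<in>P. \<forall>c\<in>P. \<forall>d\<in>P. a \<noteq> b \<and> a \<noteq> c \<and> b \<noteq> c \<longrightarrow>
        incircle a b c (d - cubic_point t) \<noteq> 0"
    "\<forall>a\<in>P. \<forall>b\<in>P. \<forall>c\<in>P. \<forall>d\<in>P. a \<noteq> b \<and> c \<noteq> d \<longrightarrow>
        incircle a b (c + cubic_point t) (d + cubic_point t) \<noteq> 0"
    using eventually_happens'[OF cofinite_neq_bot ev] by (elim exE conjE) rule
  define v where "v = cubic_point t"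
  note t = t[folded v_def]
  define D where "D = (\<lambda>a b c. cross2 (b - a) (c - a))"
  have D_swap: "D b a c = - D a b c" "D a c b = - D a b c" for a b c
    by (simp_all add: D_def cross2_def algebra_simps)
  have D1: "D a b (c + v) \<noteq> 0" if "a \<in> P" "b \<in> P" "c \<in> P" "a \<noteq> b" for a b c
    using t(2) that by (simp add: D_def algebra_simps)
  have D2: "D (a + v) (b + v) c \<noteq> 0" if "a \<in> P" "b \<in> P" "c \<in> P" "a \<noteq> b" for a b c
  proof -
    have "D (a + v) (b + v) c = - cross2 (b - a) (v + (a - c))"
      by (simp add: D_def cross2_def algebra_simps)
    thus ?thesis using t(3) that by simp
  qed
  have D0: "D a b c \<noteq> 0" "D (a + v) (b + v) (c + v) \<noteq> 0"
    if "a \<in> P" "b \<in> P" "c \<in> P" "a \<noteq> b" "a \<noteq> c" "b \<noteq> c" for a b c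
    using cr0 that by (simp_all add: D_def)
  have I0: "incircle (a + v) (b + v) (c + v) (d + v) \<noteq> 0"
    if "a \<in> P" "b \<in> P" "c \<in> P" "d \<in> P" "distinct [a, b, c, d]" for a b c d
    using in0[OF that] by (simp add: incircle_translate)
  have I1: "incircle a b c (d + v) \<noteq> 0"
    if "a \<in> P" "b \<in> P" "c \<in> P" "d \<in> P" "a \<noteq> b" "a \<noteq> c" "b \<noteq> c" for a b c d
    using t(4) that by blast
  \<comment> \<open>This covers \<open>c = a\<close>, \<open>d = b\<close>, the parallelogram
    spanned by an edge and its translate.\<close>
  have I2: "incircle a b (c + v) (d + v) \<noteq> 0"
    if "a \<in> P" "b \<in> P" "c \<in> P" "d \<in> P" "a \<noteq> b" "c \<noteq> d" for a b c d
    using t(6) that by blast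
  \<comment> \<open>Translating everything by \<open>- v\<close> leaves three unshifted points and
    \<open>d - v\<close>.\<close>
  have I3: "incircle (a + v) (b + v) (c + v) d \<noteq> 0"
    if "a \<in> P" "b \<in> P" "c \<in> P" "d \<in> P" "a \<noteq> b" "a \<noteq> c" "b \<noteq> c" for a b c d
    using t(5) that incircle_translate[of a v b c "d - v"] by fastforce
  let ?Q = "P \<union> (\<lambda>p. p + v) ` P"
  have D: "D a b c \<noteq> 0" if "a \<in> ?Q" "b \<in> ?Q" "c \<in> ?Q" "a \<noteq> b" "a \<noteq> c" "b \<noteq> c" for a b c
  proof -
    have D1': "D a (c + v) b \<noteq> 0" "D (c + v) a b \<noteq> 0"
      if "a \<in> P" "b \<in> P" "c \<in> P" "a \<noteq> b" for a b c
      using D1[OF that] D_swap(2)[of a b "c + v"] D_swap(1)[of a "c + v" b] by simp_all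
    have D2': "D (a + v) c (b + v) \<noteq> 0" "D c (a + v) (b + v) \<noteq> 0"
      if "a \<in> P" "b \<in> P" "c \<in> P" "a \<noteq> b" for a b c
      using D2[OF that] D_swap(2)[of "a + v" "b + v" c] D_swap(1)[of "a + v" c "b + v"] by simp_all
    show ?thesis using that
      by (elim UnE imageE) (simp_all add: D0 D1 D1' D2 D2')
  qed
  have I: "incircle a b c d \<noteq> 0"
    if "a \<in> ?Q" "b \<in> ?Q" "c \<in> ?Q" "d \<in> ?Q" "distinct [a, b, c, d]" for a b c d
    using that
    by (elim UnE imageE)
       (simp_all add: in0 I0 I1 I1[THEN incircle_nonzero_perms(1)] I1[THEN incircle_nonzero_perms(2)]
          I1[THEN incircle_nonzero_perms(3)] I3 I3[THEN incircle_nonzero_perms(1)]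
          I3[THEN incircle_nonzero_perms(2)] I3[THEN incircle_nonzero_perms(3)]
          I2 I2[THEN incircle_nonzero_perms(4)] I2[THEN incircle_nonzero_perms(5)]
          I2[THEN incircle_nonzero_perms(6)] I2[THEN incircle_nonzero_perms(7)]
          I2[THEN incircle_nonzero_perms(8)])
  show thesis
  proof (rule that[of v])
    show "(\<lambda>p. p + v) ` P \<inter> P = {}" using t(1) by (force simp: algebra_simps)
    show "general_position ?Q"
      unfolding general_position_def
      by (intro conjI ballI impI D[unfolded D_def] I; assumption)
  qed
qed

text \<open>Difference pairs are counted because a doubling step acts on them additively. Shifts
  \<open>e1\<close>, \<open>e2\<close>, \<open>e3\<close> in \<open>{0, v}\<close> change a pair by
  \<open>(e1 - e2, e3 - e2)\<close>; of the eight choices, all \<open>0\<close> and all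
  \<open>v\<close> agree, so seven remain.\<close>

lemma few_angles_general_position:
  "\<exists>P. finite P \<and> card P = 2 ^ d \<and> general_position P \<and>
     card ((\<lambda>(p, q, r). (p - q, r - q)) ` (P \<times> P \<times> P)) \<le> 7 ^ d"
proof (induction d)
  case 0
  show ?case by (rule exI[of _ "{0}"]) (simp add: general_position_def)
next
  case (Suc d)
  define W where "W = (\<lambda>P::(real^2) set. (\<lambda>(p, q, r). (p - q, r - q)) ` (P \<times> P \<times> P))"
  obtain P where P: "finite P" "card P = 2 ^ d" "general_position P" "card (W P) \<le> 7 ^ d"
    using Suc unfolding W_def by blast
  obtain v where v: "(\<lambda>p. p + v) ` P \<inter> P = {}" "general_position (P \<union> (\<lambda>p. p + v) ` P)"
    using general_position_double[OF P(1,3)] .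
  let ?Q = "P \<union> (\<lambda>p. p + v) ` P"
  define S where "S = set [(0, 0), (v, 0), (0, v), (v, v), (-v, 0), (0, -v), (-v, -v)]"
  have "W ?Q \<subseteq> (\<lambda>(w, s). w + s) ` (W P \<times> S)"
  proof
    fix x assume "x \<in> W ?Q"
    then obtain p q r where x: "x = (p - q, r - q)" and pqr: "p \<in> ?Q" "q \<in> ?Q" "r \<in> ?Q"
      unfolding W_def by auto
    have split: "\<exists>p0\<in>P. \<exists>e\<in>{0, v}. p = p0 + e" if "p \<in> ?Q" for p
      using that by fastforce
    obtain p0 e1 where 1: "p0 \<in> P" "e1 \<in> {0, v}" "p = p0 + e1" using split[OF pqr(1)] by blast
    obtain q0 e2 where 2: "q0 \<in> P" "e2 \<in> {0, v}" "q = q0 + e2" using split[OF pqr(2)] by blast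
    obtain r0 e3 where 3: "r0 \<in> P" "e3 \<in> {0, v}" "r = r0 + e3" using split[OF pqr(3)] by blast
    have "x = (p0 - q0, r0 - q0) + (e1 - e2, e3 - e2)"
      unfolding x 1 2 3 by simp
    moreover have "(p0 - q0, r0 - q0) \<in> W P" using 1 2 3 unfolding W_def by force
    moreover have "(e1 - e2, e3 - e2) \<in> S" using 1(2) 2(2) 3(2) by (auto simp: S_def)
    ultimately show "x \<in> (\<lambda>(w, s). w + s) ` (W P \<times> S)"
      by (intro image_eqI[of _ _ "((p0 - q0, r0 - q0), (e1 - e2, e3 - e2))"]) simp_all
  qed
  moreover have fin: "finite (W P \<times> S)" using P(1) by (simp add: W_def S_def)
  ultimately have "card (W ?Q) \<le> card (W P \<times> S)"
    by (rule surj_card_le[rotated])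
  also have "\<dots> \<le> 7 ^ d * 7"
    unfolding card_cartesian_product S_def
    by (intro mult_mono P(4) order_trans[OF card_length]) auto
  finally have "card (W ?Q) \<le> 7 ^ Suc d" by simp
  moreover have "card ?Q = 2 ^ Suc d"
    using v(1) P(1,2) by (subst card_Un_disjoint) (auto simp: card_image)
  ultimately show ?case using v(2) P(1) unfolding W_def by (intro exI[of _ ?Q]) simp
qed

subsection \<open>Asymptotics\<close>

lemma power_of_two_between:
  assumes "n > 0"
  shows "\<exists>d. n \<le> 2 ^ d \<and> 2 ^ d \<le> 2 * (n::nat)"
  using assms
proof (induction n rule: nat_induct_non_zero)
  case 1
  show ?case by (rule exI[of _ 0]) simp
next
  case (Suc n)
  then obtain d where d: "n \<le> 2 ^ d" "2 ^ d \<le> 2 * n" by blast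
  show ?case
  proof (cases "Suc n \<le> 2 ^ d")
    case True
    thus ?thesis using d by (intro exI[of _ d]) simp
  next
    \<comment> \<open>Here \<open>n = 2 ^ d\<close>, and the next power is exactly
      \<open>2 * n\<close>.\<close>
    case False
    thus ?thesis using d Suc.hyps by (intro exI[of _ "Suc d"]) simp
  qed
qed

text \<open>For \<open>n \<ge> 3\<close> the target power is at least 1 and absorbs the additive 2;
  smaller \<open>n\<close> are irrelevant to the asymptotics.\<close>

lemma bigo_cube_root:
  assumes "\<And>n. n \<ge> 3 \<Longrightarrow> real (f n) \<le> 2 + (C * real n powr e) powr (1/3)" "C \<ge> 0" "e \<ge> 0"
  shows "(\<lambda>n. real (f n)) \<in> O(\<lambda>n. real n powr (e / 3))"
proof (rule bigoI)
  show "\<forall>\<^sub>F n in sequentially. norm (real (f n)) \<le> (2 + C powr (1/3)) * norm (real n powr (e / 3))"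
    using eventually_ge_at_top[of 3]
  proof eventually_elim
    case (elim n)
    have "1 \<le> real n powr (e / 3)" using elim assms(3) by (intro ge_one_powr_ge_zero) auto
    moreover have "(C * real n powr e) powr (1/3) = C powr (1/3) * real n powr (e / 3)"
      using assms(2) by (simp add: powr_mult powr_powr)
    ultimately show ?case using assms(1)[OF elim] by (simp add: algebra_simps)
  qed
qed

text \<open>Leaving \<open>F\<close> open serves both \<open>R\<close> and \<open>R_no3l\<close>.
  The 4 is 2 for reversed triples times 2 for the \<open>2 * n\<close> measures.\<close>

lemma R_min_no3l_le:
  assumes "n \<ge> 3" "\<And>P. no_three_collinear P \<Longrightarrow> F P"
  shows "real (R_min F n) \<le> 2 + (4 * real n powr 1) powr (1/3)"
proof -
  obtain P M where P: "finite P" "card P = n" "no_three_collinear P"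
    "finite M" "card M \<le> 2 * n"
    "\<And>p q r. (p, q, r) \<in> angles P \<Longrightarrow> angle_measure p q r \<in> M"
    using few_angles_no_three_collinear[of n] assms(1) by auto
  have "R_min F n \<le> R_set P" using R_min_le[of P F] P(1-3) assms by simp
  moreover have "real (R_set P) \<le> 2 + (2 * (2 * real n)) powr (1/3)"
    using P(5) by (intro R_set_le[OF P(1,3,4) _ P(6)]) simp_all
  ultimately show ?thesis by simp
qed

text \<open>Serves \<open>R_no4c\<close> and \<open>R_gen\<close>. The cube is thinned to
  \<open>n\<close> points, but measures are still counted in the whole cube. Since
  \<open>2 ^ d \<le> 2 * n\<close>, rounding up costs a factor \<open>2 powr log 2 7 = 7\<close>,
  and 14 is twice that.\<close>

lemma R_min_general_le:
  assumes "n \<ge> 3" "\<And>P. no_three_collinear P \<Longrightarrow> no_four_concyclic P \<Longrightarrow> F P"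
  shows "real (R_min F n) \<le> 2 + (14 * real n powr log 2 7) powr (1/3)"
proof -
  obtain d where d: "n \<le> 2 ^ d" "2 ^ d \<le> 2 * n"
    using power_of_two_between[of n] assms(1) by auto
  obtain P0 where P0: "finite P0" "card P0 = 2 ^ d" "general_position P0"
    "card ((\<lambda>(p, q, r). (p - q, r - q)) ` (P0 \<times> P0 \<times> P0)) \<le> 7 ^ d"
    using few_angles_general_position by blast
  obtain P where P: "P \<subseteq> P0" "card P = n"
    using obtain_subset_with_card_n[of n P0] d(1) P0(2) by auto
  have finP: "finite P" using P(1) P0(1) by (rule finite_subset)
  define M where "M = (\<lambda>(u, w). arccos ((u \<bullet> w) / (norm u * norm w))) `
      (\<lambda>(p, q, r). (p - q, r - q)) ` (P0 \<times> P0 \<times> P0)"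
  have finM: "finite M" unfolding M_def using P0(1) by simp
  have M: "angle_measure p q r \<in> M" if "(p, q, r) \<in> angles P" for p q r
  proof -
    have "(p, q, r) \<in> P0 \<times> P0 \<times> P0" using that P(1) by (auto simp: angles_def)
    thus ?thesis unfolding M_def angle_measure_def image_image
      by (rule rev_image_eqI) simp
  qed
  have "card M \<le> 7 ^ d"
    unfolding M_def using P0(1) by (intro order_trans[OF card_image_le P0(4)]) simp
  hence "real (card M) \<le> 7 ^ d" using of_nat_le_iff[of "card M" "7 ^ d"] by simp
  also have "7 ^ d = (2 powr log 2 7) powr real d" by (simp add: powr_realpow)
  also have "\<dots> = (2 powr real d) powr log 2 7" by (rule powr_powr_swap)
  also have "\<dots> = (2 ^ d) powr log 2 7" by (simp add: powr_realpow)
  also have "\<dots> \<le> (2 * real n) powr log 2 7"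
    using of_nat_le_iff[of "2 ^ d" "2 * n", where 'a = real] d(2) by (intro powr_mono2) auto
  also have "\<dots> = 7 * real n powr log 2 7" by (simp add: powr_mult)
  finally have card_M: "real (card M) \<le> 7 * real n powr log 2 7" .
  have F: "no_three_collinear P" "no_four_concyclic P"
    using general_position_imp[OF P0(3)] P(1) no_three_collinear_subset no_four_concyclic_subset
    by blast+
  have "R_min F n \<le> R_set P" using R_min_le[of P F] P(2) finP F assms by simp
  moreover have "real (R_set P) \<le> 2 + (2 * (7 * real n powr log 2 7)) powr (1/3)"
    by (rule R_set_le[OF finP F(1) finM card_M M])
  ultimately show ?thesis by simp
qed

theorem corollary6p3:
  shows "(\<lambda>n. real (R n)) \<in> O(\<lambda>n. real n powr (1/3)) \<and>
         (\<lambda>n. real (R_no3l n)) \<in> O(\<lambda>n. real n powr (1/3)) \<and>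
         (\<lambda>n. real (R_no4c n)) \<in> O(\<lambda>n. real n powr (log 2 7 / 3)) \<and>
         (\<lambda>n. real (R_gen n)) \<in> O(\<lambda>n. real n powr (log 2 7 / 3))"
  unfolding R_def R_no3l_def R_no4c_def R_gen_def
  by (intro conjI bigo_cube_root; (rule R_min_no3l_le R_min_general_le)?) auto

end
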